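(* Let $\lambda>0$, let $\beta_1\in[0,1]$, $\beta_2\in(0,1)$, and let $\{\eta_t\}_{t\ge 1}$ be a sequence of positive step sizes. Let $\mathcal{C}=\{\mathbf{v}\in\mathbb{R}^n:\|\mathbf{v}\|_\infty\le \frac1\lambda\}$, let $\langle\cdot,\cdot\rangle$ be the Euclidean inner product on $\mathbb{R}^n$, and let $\mathbf{x}_1\in\mathcal{C}$. Then the Lion algorithm with parameters $\beta_1,\beta_2,\lambda,\{\eta_t\}$ is an instance of the stochastic Frank-Wolfe algorithm (SFW) over $\mathcal{C}$ with parameters $$\beta_{1,t}=\beta_1,\qquad \gamma_t=1-\beta_2,\qquad \eta_t^{\mathrm{SFW}}=\lambda\,\eta_t\qquad\text{for all } t\ge 1.$$ That is, for every sequence of samples $\Xi_1,\Xi_2,\dots$, the sequence of iterates $(\mathbf{x}_t)_{t\ge1}$ produced by Lion from $\mathbf{x}_1$ coincides with a sequence of iterates produced by SFW with these parameters from the same $\mathbf{x}_1$ and the same samples (for an admissible choice of the minimizers $\mathbf{u}_t$ whenever the minimizer is not unique).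
   Context: $\nabla f(\mathbf{x};\Xi)\in\mathbb{R}^n$ denotes the stochastic gradient at $\mathbf{x}$ computed from the sample (or mini-batch) $\Xi$; for the purposes of this statement it is an arbitrary function of $(\mathbf{x},\Xi)$. Lion algorithm: parameters $\beta_1,\beta_2$, step sizes $\{\eta_t\}$, weight decay $\lambda$. Initialize $\mathbf{m}_0=0$ and $\mathbf{x}_1\in\mathcal{C}$. For $t=1,2,\dots$: sample $\Xi_t$; compute $\bar{\mathbf{g}}_t=\nabla f(\mathbf{x}_t;\Xi_t)$; set $\mathbf{c}_t=\beta_1\mathbf{m}_{t-1}+(1-\beta_1)\bar{\mathbf{g}}_t$; set $\mathbf{x}_{t+1}=\mathbf{x}_t-\eta_t(\mathrm{sign}(\mathbf{c}_t)+\lambda\mathbf{x}_t)$; set $\mathbf{m}_t=\beta_2\mathbf{m}_{t-1}+(1-\beta_2)\bar{\mathbf{g}}_t$. Here $\mathrm{sign}$ acts coordinatewise, with $\mathrm{sign}(0)=0$. Stochastic Frank-Wolfe algorithm (SFW) over a convex compact set $\mathcal{C}$: parameters $\{\beta_{1,t}\},\{\gamma_t\}$, step sizes $\{\eta_t^{\mathrm{SFW}}\}$. Initialize $\mathbf{g}_0=0$ and $\mathbf{x}_1\in\mathcal{C}$. For $t=1,2,\dots$: sample $\Xi_t$; compute $\bar{\mathbf{g}}_t=\nabla f(\mathbf{x}_t;\Xi_t)$; set $\mathbf{g}_t=(1-\gamma_t)\mathbf{g}_{t-1}+\gamma_t\bar{\mathbf{g}}_t$; set $\hat{\mathbf{g}}_t=\frac{\beta_{1,t}}{1-\gamma_t}\mathbf{g}_t+\left(1-\frac{\beta_{1,t}}{1-\gamma_t}\right)\bar{\mathbf{g}}_t$;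 choose $\mathbf{u}_t\in\arg\min_{\mathbf{v}\in\mathcal{C}}\langle\mathbf{v},\hat{\mathbf{g}}_t\rangle$; set $\mathbf{x}_{t+1}=(1-\eta_t^{\mathrm{SFW}})\mathbf{x}_t+\eta_t^{\mathrm{SFW}}\mathbf{u}_t$. *)

theory Defs
  imports "HOL-Analysis.Analysis"
begin

text \<open>
  The coordinatewise sign. The library's \<^const>\<open>sgn\<close> on vectors is the normalisation
  \<open>v /\<^sub>R norm v\<close>, which is a different operation; on \<^typ>\<open>real\<close> it satisfies \<open>sgn 0 = 0\<close>.
\<close>

definition sign_vec :: "real ^ 'n \<Rightarrow> real ^ 'n" where
  "sign_vec v = (\<chi> i. sgn (v $ i))"

text \<open>
  In both algorithms \<open>grad x \<xi>\<close> is the stochastic gradient at \<open>x\<close> for the sample \<open>\<xi>\<close>, and the step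
  sizes \<open>\<eta> t\<close>, samples \<open>\<Xi> t\<close> and iterates \<open>x t\<close> are indexed by \<open>t \<ge> 1\<close>; their values at \<open>0\<close>
  play no role. The momentum sequences start at index \<open>0\<close>, so after \<open>k\<close> steps the state of Lion
  is the pair of \<open>x (k + 1)\<close> and \<open>m k\<close>.
\<close>

primrec lion_state ::
  "(real ^ 'n \<Rightarrow> 's \<Rightarrow> real ^ 'n) \<Rightarrow> real \<Rightarrow> real \<Rightarrow> real \<Rightarrow> (nat \<Rightarrow> real) \<Rightarrow> (nat \<Rightarrow> 's) \<Rightarrow>
    real ^ 'n \<Rightarrow> nat \<Rightarrow> (real ^ 'n) \<times> (real ^ 'n)" where
  "lion_state grad \<beta>1 \<beta>2 lam \<eta> \<Xi> x1 0 = (x1, 0)"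
| "lion_state grad \<beta>1 \<beta>2 lam \<eta> \<Xi> x1 (Suc k) =
    (let (x, m) = lion_state grad \<beta>1 \<beta>2 lam \<eta> \<Xi> x1 k;
         t = Suc k;
         gbar = grad x (\<Xi> t);
         c = \<beta>1 *\<^sub>R m + (1 - \<beta>1) *\<^sub>R gbar
     in (x - \<eta> t *\<^sub>R (sign_vec c + lam *\<^sub>R x),
         \<beta>2 *\<^sub>R m + (1 - \<beta>2) *\<^sub>R gbar))"

definition lion_iterate ::
  "(real ^ 'n \<Rightarrow> 's \<Rightarrow> real ^ 'n) \<Rightarrow> real \<Rightarrow> real \<Rightarrow> real \<Rightarrow> (nat \<Rightarrow> real) \<Rightarrow> (nat \<Rightarrow> 's) \<Rightarrow>
    real ^ 'n \<Rightarrow> nat \<Rightarrow> real ^ 'n" where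
  "lion_iterate grad \<beta>1 \<beta>2 lam \<eta> \<Xi> x1 t = fst (lion_state grad \<beta>1 \<beta>2 lam \<eta> \<Xi> x1 (t - 1))"

text \<open>
  The minimisers \<open>u t\<close> of stochastic Frank-Wolfe need not be unique, so its runs form a relation:
  \<open>x\<close> is a possible sequence of iterates from \<open>x1\<close>, for some admissible choice of the \<open>u t\<close>.
\<close>

definition sfw_iterates ::
  "(real ^ 'n \<Rightarrow> 's \<Rightarrow> real ^ 'n) \<Rightarrow> (real ^ 'n) set \<Rightarrow> (nat \<Rightarrow> real) \<Rightarrow> (nat \<Rightarrow> real) \<Rightarrow>
    (nat \<Rightarrow> real) \<Rightarrow> (nat \<Rightarrow> 's) \<Rightarrow> real ^ 'n \<Rightarrow> (nat \<Rightarrow> real ^ 'n) \<Rightarrow> bool" where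
  "sfw_iterates grad C \<beta>1 \<gamma> \<eta> \<Xi> x1 x \<longleftrightarrow>
    convex C \<and> compact C \<and> x1 \<in> C \<and> x 1 = x1 \<and>
    (\<exists>gbar g ghat u. g 0 = 0 \<and>
      (\<forall>t\<ge>1.
        gbar t = grad (x t) (\<Xi> t) \<and>
        g t = (1 - \<gamma> t) *\<^sub>R g (t - 1) + \<gamma> t *\<^sub>R gbar t \<and>
        ghat t = (\<beta>1 t / (1 - \<gamma> t)) *\<^sub>R g t + (1 - \<beta>1 t / (1 - \<gamma> t)) *\<^sub>R gbar t \<and>
        is_arg_min (\<lambda>v. v \<bullet> ghat t) (\<lambda>v. v \<in> C) (u t) \<and>
        x (t + 1) = (1 - \<eta> t) *\<^sub>R x t + \<eta> t *\<^sub>R u t))"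

end

theory Submission
  imports Defs
begin

text \<open>
  Two observations make Lion a Frank-Wolfe method. First, a linear form with coefficient vector
  \<open>c\<close> splits into coordinates over a cube of radius \<open>r\<close>, so \<open>- r *\<^sub>R sign_vec c\<close> minimises it:
  each coordinate goes to the end of its interval opposite in sign to \<open>c $ i\<close>, and where
  \<open>c $ i = 0\<close> any value, in particular \<open>0\<close>, is optimal (lemma \<open>sign_vec_arg_min\<close>). With
  \<open>r = 1 / lam\<close> and step \<open>lam * \<eta> t\<close>, moving towards this minimiser is Lion's update; the weight
  decay is the shrinking factor of the convex combination.

  Second, the momentum of Lion is the gradient estimate \<open>g\<close> of Frank-Wolfe when
  \<open>\<gamma> = 1 - \<beta>2\<close>, and the search direction of Lion, which mixes the new gradient with the
  \<^emph>\<open>previous\<close> momentum, becomes the combination of the new gradient with the \<^emph>\<open>updated\<close> momentum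
  once the previous momentum is eliminated (lemma \<open>momentum_extrapolation\<close>).
\<close>

text \<open>
  As a box the cube is visibly convex and compact, and membership is a condition on coordinates.
\<close>

lemma infnorm_ball_eq_cbox:
  fixes r :: real
  shows "{v :: real ^ 'n. infnorm v \<le> r} = cbox (\<chi> i. - r) (\<chi> i. r)"
proof -
  have "infnorm v \<le> r \<longleftrightarrow> (\<forall>i. \<bar>v $ i\<bar> \<le> r)" for v :: "real ^ 'n"
  proof
    assume "infnorm v \<le> r"
    then show "\<forall>i. \<bar>v $ i\<bar> \<le> r"
      using component_le_infnorm_cart order_trans by blast
  next
    assume "\<forall>i. \<bar>v $ i\<bar> \<le> r"
    then show "infnorm v \<le> r"
      unfolding infnorm_cart by (intro cSup_least) auto
  qed
  then show ?thesis
    by (auto simp: mem_box_cart abs_le_iff minus_le_iff)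
qed

text \<open>
  The minimum value is \<open>- r\<close> times the sum of the \<open>\<bar>c $ i\<bar>\<close>, which bounds the form from below
  one coordinate at a time.
\<close>

lemma sign_vec_arg_min:
  fixes c :: "real ^ 'n" and r :: real
  assumes "r \<ge> 0"
  shows "is_arg_min (\<lambda>v. v \<bullet> c) (\<lambda>v. v \<in> {v. infnorm v \<le> r}) (- r *\<^sub>R sign_vec c)"
proof -
  have mem: "- r *\<^sub>R sign_vec c \<in> cbox (\<chi> i. - r) (\<chi> i. r)"
    using assms by (auto simp: mem_box_cart sign_vec_def sgn_real_def)
  have le: "(- r *\<^sub>R sign_vec c) \<bullet> c \<le> v \<bullet> c" if "v \<in> cbox (\<chi> i. - r) (\<chi> i. r)" for v
    unfolding inner_vec_def
  proof (rule sum_mono)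
    fix i
    have "\<bar>v $ i\<bar> \<le> r"
      using that by (auto simp: mem_box_cart abs_le_iff minus_le_iff)
    then have "\<bar>v $ i * c $ i\<bar> \<le> r * \<bar>c $ i\<bar>"
      by (simp add: abs_mult mult_right_mono)
    then have "- (r * \<bar>c $ i\<bar>) \<le> v $ i * c $ i"
      by linarith
    moreover have "(- r *\<^sub>R sign_vec c) $ i * c $ i = - (r * \<bar>c $ i\<bar>)"
      by (simp add: sign_vec_def sgn_real_def)
    ultimately show "(- r *\<^sub>R sign_vec c) $ i \<bullet> c $ i \<le> v $ i \<bullet> c $ i"
      by (simp only: inner_real_def)
  qed
  show ?thesis
    unfolding infnorm_ball_eq_cbox is_arg_min_linorder using mem le by blast
qed

text \<open>
  The left-hand side is the extrapolated estimate of Frank-Wolfe with \<open>g\<close> the updated momentum;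
  the contributions \<open>(b / a) *\<^sub>R h\<close> to the gradient coefficient cancel.
\<close>

lemma momentum_extrapolation:
  fixes m h :: "'a :: real_vector" and a b :: real
  assumes "a \<noteq> 0"
  shows "(b / a) *\<^sub>R (a *\<^sub>R m + (1 - a) *\<^sub>R h) + (1 - b / a) *\<^sub>R h = b *\<^sub>R m + (1 - b) *\<^sub>R h"
proof -
  have "(b / a) *\<^sub>R (a *\<^sub>R m + (1 - a) *\<^sub>R h) + (1 - b / a) *\<^sub>R h
      = (b / a * a) *\<^sub>R m + (b / a * (1 - a) + (1 - b / a)) *\<^sub>R h"
    by (simp only: scaleR_add_right scaleR_add_left scaleR_scaleR add.assoc)
  also have "b / a * (1 - a) + (1 - b / a) = 1 - b"
    using assms by (simp add: field_simps)
  finally show ?thesis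
    using assms by simp
qed

theorem theorem1:
  fixes grad :: "real ^ 'n \<Rightarrow> 's \<Rightarrow> real ^ 'n"
    and lam \<beta>1 \<beta>2 :: real
    and \<eta> :: "nat \<Rightarrow> real"
    and C :: "(real ^ 'n) set"
    and x1 :: "real ^ 'n"
  assumes "lam > 0"
    and "\<beta>1 \<in> {0..1}"
    and "\<beta>2 \<in> {0<..<1}"
    and "\<forall>t\<ge>1. \<eta> t > 0"
    and "C = {v. infnorm v \<le> 1 / lam}"
    and "x1 \<in> C"
  shows "\<forall>\<Xi> :: nat \<Rightarrow> 's. \<exists>x.
    sfw_iterates grad C (\<lambda>t. \<beta>1) (\<lambda>t. 1 - \<beta>2) (\<lambda>t. lam * \<eta> t) \<Xi> x1 x \<and>
    (\<forall>t\<ge>1. x t = lion_iterate grad \<beta>1 \<beta>2 lam \<eta> \<Xi> x1 t)"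
proof
  fix \<Xi> :: "nat \<Rightarrow> 's"
  define x where "x = lion_iterate grad \<beta>1 \<beta>2 lam \<eta> \<Xi> x1"
  define m where "m k = snd (lion_state grad \<beta>1 \<beta>2 lam \<eta> \<Xi> x1 k)" for k
  define h where "h t = grad (x t) (\<Xi> t)" for t
  define c where "c t = \<beta>1 *\<^sub>R m (t - 1) + (1 - \<beta>1) *\<^sub>R h t" for t
  define u where "u t = - (1 / lam) *\<^sub>R sign_vec (c t)" for t

  have lion: "x (t + 1) = x t - \<eta> t *\<^sub>R (sign_vec (c t) + lam *\<^sub>R x t)"
      "m t = \<beta>2 *\<^sub>R m (t - 1) + (1 - \<beta>2) *\<^sub>R h t" if "t \<ge> 1" for t
    using that
    by (cases t; simp add: x_def m_def h_def c_def lion_iterate_def Let_def case_prod_beta)+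

  have "(\<beta>1 / \<beta>2) *\<^sub>R m t + (1 - \<beta>1 / \<beta>2) *\<^sub>R h t = c t" if "t \<ge> 1" for t
    using momentum_extrapolation[of \<beta>2 \<beta>1 "m (t - 1)" "h t"] assms(3) lion(2)[OF that]
    by (simp add: c_def)
  moreover have "is_arg_min (\<lambda>v. v \<bullet> c t) (\<lambda>v. v \<in> C) (u t)" for t
    unfolding u_def assms(5) using assms(1) by (intro sign_vec_arg_min) simp
  moreover have "x (t + 1) = (1 - lam * \<eta> t) *\<^sub>R x t + (lam * \<eta> t) *\<^sub>R u t" if "t \<ge> 1" for t
    unfolding lion(1)[OF that] using assms(1) by (simp add: u_def algebra_simps)
  moreover have "convex C" "compact C"
    unfolding assms(5) infnorm_ball_eq_cbox by (auto intro: convex_box)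
  moreover have "x 1 = x1" "m 0 = 0"
    by (simp_all add: x_def m_def lion_iterate_def)
  ultimately have "sfw_iterates grad C (\<lambda>t. \<beta>1) (\<lambda>t. 1 - \<beta>2) (\<lambda>t. lam * \<eta> t) \<Xi> x1 x"
    unfolding sfw_iterates_def using assms(6) lion(2)
    by (intro conjI exI[of _ h] exI[of _ m] exI[of _ c] exI[of _ u]) (auto simp: h_def)
  then show "\<exists>x. sfw_iterates grad C (\<lambda>t. \<beta>1) (\<lambda>t. 1 - \<beta>2) (\<lambda>t. lam * \<eta> t) \<Xi> x1 x \<and>
      (\<forall>t\<ge>1. x t = lion_iterate grad \<beta>1 \<beta>2 lam \<eta> \<Xi> x1 t)"
    unfolding x_def by blast
qed

end
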